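(* Let $c\in(0,1]$, let $D\subset\mathbb R$ be $c$-uniformly disconnected, let $(X,d)$ be a metric space, and let $\alpha>0$. Suppose that $L\ge0$ and $F:D\to\mathcal K(X)$ satisfy, for every $u,v\in D$, $$d_H(F(u),F(v))\le L|u-v|^\alpha.$$ Then, for every $u_*\in D$ and $x_*\in F(u_* )$, there exists a selection $f:D\to X$ of $F$ satisfying $f(u_* )=x_*$ and, for every $u,v\in D$, $$d(f(u),f(v))\le 8c^{-\alpha}L|u-v|^\alpha.$$ Consequently (taking $L=[F]_{\alpha,D}$), $f$ can be chosen with $f(u_* )=x_*$ and $$[f]_{\alpha,D}\le 8c^{-\alpha}[F]_{\alpha,D}.$$
   Context: For a metric space $(X,d)$, $\mathcal K(X)$ is the family of nonempty compact subsets of $X$, with Hausdorff distance $d_H$. A selection of $F:D\to\mathcal K(X)$ is a map $f:D\to X$ with $f(u)\in F(u)$ for every $u\in D$. $[F]_{\alpha,D}$ is the least $L\ge0$ with $d_H(F(u),F(v))\le L|u-v|^\alpha$ for all $u,v\in D$; $[f]_{\alpha,D}$ is defined analogously for $f:D\to X$ with $d$ in place of $d_H$. For $c\in(0,1]$, $D\subset\mathbb R$ is $c$-uniformly disconnected if, for every pair of distinct points $u,v\in D$ and every finite chain $u=u_0,u_1,\ldots,u_N=v$ with all $u_i\in D$, one has $\max_{1\le i\le N}|u_i-u_{i-1}|\ge c|u-v|$. *)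

theory Defs
  imports "HOL-Analysis.Analysis"
begin

(* Meaningful for nonempty bounded sets, in particular for nonempty compact ones:
   the suprema are real-valued, hence unspecified on unbounded sets. *)
definition hausdorff_dist :: "'a::metric_space set \<Rightarrow> 'a set \<Rightarrow> real" where
  "hausdorff_dist A B = max (SUP x\<in>A. infdist x B) (SUP y\<in>B. infdist y A)"

definition selection_on :: "real set \<Rightarrow> (real \<Rightarrow> 'a set) \<Rightarrow> (real \<Rightarrow> 'a) \<Rightarrow> bool" where
  "selection_on D F f \<longleftrightarrow> (\<forall>u\<in>D. f u \<in> F u)"

(* The distance \<delta> on the target is a parameter, so that the same notion serves set-valued
   maps (\<delta> = hausdorff_dist) and point-valued maps (\<delta> = dist). *)
definition holder_bound ::
  "('b \<Rightarrow> 'b \<Rightarrow> real) \<Rightarrow> real \<Rightarrow> real set \<Rightarrow> (real \<Rightarrow> 'b) \<Rightarrow> real \<Rightarrow> bool" where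
  "holder_bound \<delta> \<alpha> D g L \<longleftrightarrow>
     0 \<le> L \<and> (\<forall>u\<in>D. \<forall>v\<in>D. \<delta> (g u) (g v) \<le> L * \<bar>u - v\<bar> powr \<alpha>)"

(* Unspecified if g has no Hoelder bound at all; otherwise the least element exists,
   see holder_const_least below. *)
definition holder_const ::
  "('b \<Rightarrow> 'b \<Rightarrow> real) \<Rightarrow> real \<Rightarrow> real set \<Rightarrow> (real \<Rightarrow> 'b) \<Rightarrow> real" where
  "holder_const \<delta> \<alpha> D g = (LEAST L. holder_bound \<delta> \<alpha> D g L)"

lemma holder_const_least:
  assumes "holder_bound \<delta> \<alpha> D g L"
  shows "holder_bound \<delta> \<alpha> D g (holder_const \<delta> \<alpha> D g)"
    and "holder_const \<delta> \<alpha> D g \<le> L"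
proof -
  define S where "S = {K. holder_bound \<delta> \<alpha> D g K}"
  have S_eq: "S = {0..} \<inter> (\<Inter>u\<in>D. \<Inter>v\<in>D. {K. \<delta> (g u) (g v) \<le> K * \<bar>u - v\<bar> powr \<alpha>})"
    by (auto simp: S_def holder_bound_def)
  have "closed S"
    unfolding S_eq
    by (intro closed_Int closed_INT ballI closed_atLeast closed_Collect_le continuous_intros)
  moreover have bdd: "bdd_below S"
    by (rule bdd_belowI[of _ 0]) (auto simp: S_def holder_bound_def)
  moreover have "S \<noteq> {}"
    using assms by (auto simp: S_def)
  ultimately have "Inf S \<in> S"
    by (intro closed_contains_Inf)
  then have inf: "holder_bound \<delta> \<alpha> D g (Inf S)"
    by (simp add: S_def)
  have low: "Inf S \<le> K" if "holder_bound \<delta> \<alpha> D g K" for K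
    using that bdd by (intro cInf_lower) (auto simp: S_def)
  have eq: "holder_const \<delta> \<alpha> D g = Inf S"
    unfolding holder_const_def using inf low by (rule Least_equality)
  show "holder_bound \<delta> \<alpha> D g (holder_const \<delta> \<alpha> D g)"
    using inf by (simp add: eq)
  show "holder_const \<delta> \<alpha> D g \<le> L"
    using low[OF assms] by (simp add: eq)
qed

(* A chain is given by N and the values w 0, ..., w N. Since u \<noteq> v forces N \<ge> 1,
   the maximum is over a nonempty finite set. *)
definition uniformly_disconnected :: "real \<Rightarrow> real set \<Rightarrow> bool" where
  "uniformly_disconnected c D \<longleftrightarrow>
     (\<forall>u\<in>D. \<forall>v\<in>D. u \<noteq> v \<longrightarrow>
       (\<forall>(N::nat) (w::nat \<Rightarrow> real).
          w 0 = u \<and> w N = v \<and> (\<forall>i\<le>N. w i \<in> D) \<longrightarrow>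
          Max ((\<lambda>i. \<bar>w i - w (i - 1)\<bar>) ` {1..N}) \<ge> c * \<bar>u - v\<bar>))"

end

theory Submission
  imports Defs
begin

text \<open>Points of \<open>D\<close> joined by chains with steps at most \<open>2 powr (n / \<alpha>)\<close> lie in the same
  class at scale \<open>n\<close>; uniform disconnectedness bounds the diameter of a class, so \<open>F\<close> moves by at most
  \<open>M * 2 powr n\<close> inside it, where \<open>M = c powr (- \<alpha>) * L\<close>. On a finite subset one selects along the
  resulting tree of classes, passing from a representative to a nearest point in a subclass: the
  moves form a geometric series of ratio \<open>1/2\<close>, so values in one class of scale \<open>n\<close> differ by at most
  \<open>4 * M * 2 powr n\<close>. Two points that are first joined at scale \<open>n\<close> have
  \<open>2 powr n < 2 * \<bar>u - v\<bar> powr \<alpha>\<close>, whence the factor 8. Tychonoff's theorem passes from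
  finite subsets to all of \<open>D\<close>.\<close>

section \<open>Jumps of monotone predicates and nearest points\<close>

text \<open>Scales range over all integers, so a first scale needs a failure somewhere below as well
  as a success: upward induction from \<open>a\<close> would otherwise carry the failure up to
  \<open>b\<close>.\<close>

lemma mono_pred_jump_int:
  fixes P :: "int \<Rightarrow> bool"
  assumes mono: "\<And>m n. P m \<Longrightarrow> m \<le> n \<Longrightarrow> P n" and "P b" and "\<not> P a"
  obtains m where "P m" and "\<not> P (m - 1)"
proof -
  have "a \<le> b"
    using assms by (meson linear)
  have "\<exists>m. P m \<and> \<not> P (m - 1)"
  proof (rule ccontr)
    assume *: "\<nexists>m. P m \<and> \<not> P (m - 1)"
    have "\<not> P n" if "a \<le> n" for n
      using that
    proof (induction n rule: int_ge_induct)
      case (step i)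
      then show ?case using *[simplified, rule_format, of "i + 1"] by auto
    qed (rule \<open>\<not> P a\<close>)
    then show False
      using \<open>a \<le> b\<close> \<open>P b\<close> by blast
  qed
  then show ?thesis
    using that by blast
qed

lemma hausdorff_dist_nearest:
  fixes A B :: "'a::metric_space set"
  assumes "compact A" and "compact B" and "B \<noteq> {}" and "x \<in> A"
  obtains y where "y \<in> B" and "dist x y \<le> hausdorff_dist A B"
proof -
  have "continuous_on B (dist x)"
    by (intro continuous_intros)
  then obtain y where y: "y \<in> B" "\<And>z. z \<in> B \<Longrightarrow> dist x y \<le> dist x z"
    using continuous_attains_inf[OF assms(2,3)] by blast
  have "dist x y \<le> infdist x B"
    using assms(3) y(2) by (simp add: infdist_notempty cINF_greatest)
  \<comment> \<open>Compactness of \<open>A\<close> bounds the image, so that the real-valued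
    supremum really is an upper bound.\<close>
  also have "continuous_on A (\<lambda>x. infdist x B)"
    by (intro continuous_intros)
  then have "bdd_above ((\<lambda>x. infdist x B) ` A)"
    by (intro bounded_imp_bdd_above compact_imp_bounded compact_continuous_image assms(1))
  then have "infdist x B \<le> (SUP x\<in>A. infdist x B)"
    using assms(4) by (rule cSUP_upper2) auto
  also have "\<dots> \<le> hausdorff_dist A B"
    by (simp add: hausdorff_dist_def)
  finally show ?thesis
    using that y(1) by blast
qed

section \<open>Selections on finite sets along a tree of classes\<close>

text \<open>The bound to the root value \<open>x0\<close> is carried through the induction because
  the pairwise bound follows from it: two values in different pieces are compared through
  \<open>x0\<close>, hence 4 = 2 + 2. The constant 2 reproduces itself, since one jump
  \<open>M * 2 powr m\<close> plus the radius \<open>2 * M * 2 powr (m - 1)\<close> is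
  \<open>2 * M * 2 powr m\<close>.\<close>

lemma finite_tree_selection:
  fixes E :: "int \<Rightarrow> 'b \<Rightarrow> 'b \<Rightarrow> bool" and F :: "'b \<Rightarrow> 'a::metric_space set"
  assumes refl: "\<And>n u. E n u u"
    and sym: "\<And>n u v. E n u v \<Longrightarrow> E n v u"
    and trans: "\<And>n u v w. E n u v \<Longrightarrow> E n v w \<Longrightarrow> E n u w"
    and mono: "\<And>m n u v. E m u v \<Longrightarrow> m \<le> n \<Longrightarrow> E n u v"
    and joined: "\<And>u v. u \<in> D \<Longrightarrow> v \<in> D \<Longrightarrow> \<exists>n. E n u v"
    and separated: "\<And>u v. u \<in> D \<Longrightarrow> v \<in> D \<Longrightarrow> u \<noteq> v \<Longrightarrow> \<exists>n. \<not> E n u v"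
    and step: "\<And>n u v x. u \<in> D \<Longrightarrow> v \<in> D \<Longrightarrow> E n u v \<Longrightarrow> x \<in> F u \<Longrightarrow>
                 \<exists>y\<in>F v. dist x y \<le> M * 2 powr n"
    and "0 \<le> M"
    and "finite S" and "S \<subseteq> D" and "u0 \<in> S" and "x0 \<in> F u0"
  shows "\<exists>f. f u0 = x0 \<and> (\<forall>u\<in>S. f u \<in> F u) \<and>
           (\<forall>n. \<forall>u\<in>S. E n u u0 \<longrightarrow> dist (f u) x0 \<le> 2 * M * 2 powr n) \<and>
           (\<forall>n. \<forall>u\<in>S. \<forall>v\<in>S. E n u v \<longrightarrow> dist (f u) (f v) \<le> 4 * M * 2 powr n)"
  using \<open>finite S\<close> \<open>S \<subseteq> D\<close> \<open>u0 \<in> S\<close> \<open>x0 \<in> F u0\<close>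
proof (induction S arbitrary: u0 x0 rule: finite_psubset_induct)
  case (psubset S)
  show ?case
  proof (cases "S = {u0}")
    case True
    then show ?thesis
      using psubset.prems \<open>0 \<le> M\<close> by (intro exI[of _ "\<lambda>_. x0"]) auto
  next
    case False
    define P where "P n \<longleftrightarrow> (\<forall>u\<in>S. E n u0 u)" for n
    have P_mono: "P n" if "P m" "m \<le> n" for m n
      using that mono unfolding P_def by blast
    have "\<forall>u\<in>S. \<exists>n. E n u0 u"
      using joined psubset.prems by blast
    then obtain N where N: "\<And>u. u \<in> S \<Longrightarrow> E (N u) u0 u"
      by metis
    have "P (Max (N ` S))"
      unfolding P_def using N mono psubset.hyps by (meson Max_ge finite_imageI imageI)
    moreover obtain a where "\<not> P a"
      using False separated psubset.prems unfolding P_def by blast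
    \<comment> \<open>\<open>m\<close> is the smallest scale at which all of \<open>S\<close> is one
      class.\<close>
    ultimately obtain m where m: "P m" "\<not> P (m - 1)"
      using mono_pred_jump_int[of P] P_mono by metis
    obtain p where p: "p \<in> S" "\<not> E (m - 1) u0 p"
      using m(2) unfolding P_def by blast
    have all: "E m u v" if "u \<in> S" "v \<in> S" for u v
      using that m(1) sym trans unfolding P_def by blast
    \<comment> \<open>Only the one subclass containing \<open>p\<close> is split off; other
      subclasses stay in \<open>S - C\<close> together with \<open>u0\<close> and are left to the
      recursion. No pair across the cut is joined below scale \<open>m\<close>.\<close>
    define C where "C = {v\<in>S. E (m - 1) v p}"
    have sub: "C \<subset> S" "S - C \<subset> S" and u0: "u0 \<in> S - C" and pC: "p \<in> C"
      using p refl psubset.prems unfolding C_def by auto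
    have SD: "C \<subseteq> D" "S - C \<subseteq> D"
      using sub psubset.prems(1) by auto
    have far: "m \<le> n" if "u \<in> C" "v \<in> S - C" "E n u v" for u v n
    proof (rule ccontr)
      assume "\<not> m \<le> n"
      then have "E (m - 1) u v"
        using that(3) mono by force
      then show False
        using that(1,2) sym trans unfolding C_def by blast
    qed
    \<comment> \<open>The piece \<open>S - C\<close> keeps the root \<open>u0\<close> with value
      \<open>x0\<close>; the piece \<open>C\<close> gets the root \<open>p\<close> with a value
      close to \<open>x0\<close>.\<close>
    obtain y where y: "y \<in> F p" "dist x0 y \<le> M * 2 powr m"
      using step[of u0 p m x0] all psubset.prems p by blast
    obtain g where g: "g u0 = x0" "\<And>u. u \<in> S - C \<Longrightarrow> g u \<in> F u"
      "\<And>n u. u \<in> S - C \<Longrightarrow> E n u u0 \<Longrightarrow> dist (g u) x0 \<le> 2 * M * 2 powr n"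
      "\<And>n u v. u \<in> S - C \<Longrightarrow> v \<in> S - C \<Longrightarrow> E n u v \<Longrightarrow> dist (g u) (g v) \<le> 4 * M * 2 powr n"
      using psubset.IH[OF sub(2) SD(2) u0 psubset.prems(3)] by blast
    obtain h where h: "h p = y" "\<And>u. u \<in> C \<Longrightarrow> h u \<in> F u"
      "\<And>n u. u \<in> C \<Longrightarrow> E n u p \<Longrightarrow> dist (h u) y \<le> 2 * M * 2 powr n"
      "\<And>n u v. u \<in> C \<Longrightarrow> v \<in> C \<Longrightarrow> E n u v \<Longrightarrow> dist (h u) (h v) \<le> 4 * M * 2 powr n"
      using psubset.IH[OF sub(1) SD(1) pC y(1)] by blast
    have scale: "M * 2 powr m \<le> M * 2 powr n" if "m \<le> n" for n
      using that \<open>0 \<le> M\<close> by (intro mult_left_mono powr_mono) auto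
    have hx: "dist (h u) x0 \<le> 2 * M * 2 powr m" if "u \<in> C" for u
    proof -
      have "dist (h u) y \<le> 2 * M * 2 powr (m - 1)"
        using h(3) that unfolding C_def by blast
      also have "\<dots> = M * 2 powr m"
        by (simp add: powr_diff)
      finally show ?thesis
        using y(2) dist_triangle[of "h u" x0 y] by (simp add: dist_commute)
    qed
    \<comment> \<open>Both values lie within \<open>2 * M * 2 powr m\<close> of \<open>x0\<close>,
      and \<open>far\<close> lifts the scale from \<open>m\<close> to \<open>n\<close>.\<close>
    have cross: "dist (h u) (g v) \<le> 4 * M * 2 powr n" if "u \<in> C" "v \<in> S - C" "E n u v" for u v n
    proof -
      have "dist (g v) x0 \<le> 2 * M * 2 powr m"
        using g(3) that(2) all psubset.prems by blast
      then show ?thesis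
        using hx[OF that(1)] scale[OF far[OF that]] dist_triangle2[of "h u" "g v" x0] by linarith
    qed
    define f where "f u = (if u \<in> C then h u else g u)" for u
    show ?thesis
    proof (intro exI[of _ f] conjI allI ballI impI)
      show "f u0 = x0"
        using u0 g(1) by (simp add: f_def)
      show "f u \<in> F u" if "u \<in> S" for u
        using that g(2) h(2) by (simp add: f_def)
      \<comment> \<open>For \<open>u\<close> in \<open>C\<close>, being joined to \<open>u0\<close>
        outside \<open>C\<close> forces \<open>m \<le> n\<close>, so \<open>hx\<close>
        suffices.\<close>
      show "dist (f u) x0 \<le> 2 * M * 2 powr n" if "u \<in> S" "E n u u0" for n u
        using that g(3)[of u n] hx[of u] scale[of n] far[of u u0 n] u0 by (fastforce simp: f_def)
      show "dist (f u) (f v) \<le> 4 * M * 2 powr n" if "u \<in> S" "v \<in> S" "E n u v" for n u v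
        using that g(4)[of u v n] h(4)[of u v n] cross[of u v n] cross[of v u n] sym
        by (auto simp: f_def dist_commute)
    qed
  qed
qed

section \<open>From finite subsets to the whole domain\<close>

text \<open>The product of the sets \<open>F u\<close> is compact, and each distance constraint is
  closed because it involves two coordinates only. Finitely many constraints see finitely many
  points, so \<open>fin\<close> yields the finite intersection property.\<close>

lemma compact_selection_from_finite:
  fixes F :: "'b \<Rightarrow> 'a::metric_space set"
  assumes comp: "\<And>u. u \<in> D \<Longrightarrow> compact (F u)"
    and fin: "\<And>S. finite S \<Longrightarrow> S \<subseteq> D \<Longrightarrow>
       \<exists>f. (\<forall>u\<in>S. f u \<in> F u) \<and> (\<forall>u\<in>S. \<forall>v\<in>S. dist (f u) (f v) \<le> K u v)"
  shows "\<exists>f. (\<forall>u\<in>D. f u \<in> F u) \<and> (\<forall>u\<in>D. \<forall>v\<in>D. dist (f u) (f v) \<le> K u v)"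
proof -
  define X where "X = product_topology (\<lambda>_::'b. euclidean :: 'a topology) D"
  define C where "C = (\<lambda>(u, v). {f \<in> topspace X. dist (f u) (f v) \<le> K u v})"
  have "compactin X (PiE D F)"
    unfolding X_def using comp by (simp add: compactin_PiE)
  then have fip: "PiE D F \<inter> \<Inter>\<V> \<noteq> {}"
    if "\<forall>V\<in>\<V>. closedin X V" "\<forall>\<U>. finite \<U> \<and> \<U> \<subseteq> \<V> \<longrightarrow> PiE D F \<inter> \<Inter>\<U> \<noteq> {}" for \<V>
    using that unfolding compactin_fip by simp
  have closed: "closedin X (C q)" if qD: "q \<in> D \<times> D" for q
  proof -
    obtain u v where q: "q = (u, v)" "u \<in> D" "v \<in> D"
      using qD by blast
    have "continuous_map X euclidean (\<lambda>f. f u)" "continuous_map X euclidean (\<lambda>f. f v)"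
      unfolding X_def using q by (auto intro: continuous_map_product_projection)
    then have "continuous_map X (prod_topology euclidean euclidean) (\<lambda>f. (f u, f v))"
      by (rule continuous_map_pairedI)
    moreover have "continuous_map (prod_topology euclidean euclidean) euclidean
        (\<lambda>(x :: 'a, y). dist x y)"
      by (auto simp: case_prod_unfold intro!: continuous_intros)
    ultimately have "continuous_map X euclidean ((\<lambda>(x, y). dist x y) \<circ> (\<lambda>f. (f u, f v)))"
      by (rule continuous_map_compose)
    then have "closedin X {f \<in> topspace X. ((\<lambda>(x, y). dist x y) \<circ> (\<lambda>f. (f u, f v))) f \<in> {..K u v}}"
      by (rule closedin_continuous_map_preimage) simp
    then show ?thesis
      by (simp add: C_def q)
  qed
  have finite_meet: "PiE D F \<inter> \<Inter>\<U> \<noteq> {}" if \<U>: "finite \<U>" "\<U> \<subseteq> C ` (D \<times> D)" for \<U>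
  proof -
    obtain Q where Q: "finite Q" "Q \<subseteq> D \<times> D" "\<U> = C ` Q"
      using finite_subset_image[OF \<U>] by blast
    define S where "S = fst ` Q \<union> snd ` Q"
    have S: "finite S" "S \<subseteq> D"
      using Q by (auto simp: S_def)
    obtain f where f: "\<And>u. u \<in> S \<Longrightarrow> f u \<in> F u"
      "\<And>u v. u \<in> S \<Longrightarrow> v \<in> S \<Longrightarrow> dist (f u) (f v) \<le> K u v"
      using fin[OF S] by blast
    \<comment> \<open>A selection on a singleton witnesses nonemptiness.\<close>
    have ne: "F u \<noteq> {}" if "u \<in> D" for u
      using fin[of "{u}"] that by auto
    \<comment> \<open>Values off \<open>S\<close> do not enter the constraints in \<open>Q\<close>;
      arbitrary choices there, and \<open>restrict\<close>, turn \<open>f\<close> into a point of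
      the product.\<close>
    define g where "g = restrict (\<lambda>u. if u \<in> S then f u else SOME x. x \<in> F u) D"
    have "g \<in> PiE D F"
      using f(1) ne by (auto simp: g_def some_in_eq)
    moreover have "g \<in> C q" if "q \<in> Q" for q
    proof -
      have "fst q \<in> S" "snd q \<in> S"
        using that by (auto simp: S_def)
      then show ?thesis
        using f(2) \<open>S \<subseteq> D\<close> by (auto simp: C_def X_def g_def case_prod_unfold)
    qed
    ultimately show ?thesis
      using Q(3) by blast
  qed
  have "PiE D F \<inter> \<Inter>(C ` (D \<times> D)) \<noteq> {}"
    by (rule fip) (use closed finite_meet in \<open>simp_all only: ball_simps, simp_all\<close>)
  then obtain f where "f \<in> PiE D F" "\<And>u v. u \<in> D \<Longrightarrow> v \<in> D \<Longrightarrow> f \<in> C (u, v)"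
    by blast
  then show ?thesis
    by (intro exI[of _ f]) (auto simp: C_def)
qed

section \<open>Chains and uniform disconnectedness\<close>

text \<open>As a reflexive transitive closure this is reflexive at every real, also outside
  \<open>D\<close>, as \<open>finite_tree_selection\<close> requires.\<close>

definition chained :: "real set \<Rightarrow> real \<Rightarrow> real \<Rightarrow> real \<Rightarrow> bool" where
  "chained D t = (\<lambda>u v. u \<in> D \<and> v \<in> D \<and> \<bar>u - v\<bar> \<le> t)\<^sup>*\<^sup>*"

lemma chained_refl: "chained D t u u"
  by (simp add: chained_def)

lemma chained_trans: "chained D t u v \<Longrightarrow> chained D t v w \<Longrightarrow> chained D t u w"
  unfolding chained_def by (rule rtranclp_trans)

lemma chained_sym: "chained D t u v \<Longrightarrow> chained D t v u"
  unfolding chained_def by (rule sympD[OF symp_rtranclp]) (auto intro: sympI)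

lemma chained_mono: "chained D s u v \<Longrightarrow> s \<le> t \<Longrightarrow> chained D t u v"
  unfolding chained_def by (erule mono_rtranclp[rule_format, rotated]) auto

lemma chained_step: "u \<in> D \<Longrightarrow> v \<in> D \<Longrightarrow> \<bar>u - v\<bar> \<le> t \<Longrightarrow> chained D t u v"
  unfolding chained_def by (rule r_into_rtranclp) simp

text \<open>The largest step of a connecting chain is at most \<open>t\<close>, while
  disconnectedness makes it at least \<open>c * \<bar>u - v\<bar>\<close>.\<close>

lemma uniformly_disconnected_chained:
  assumes "uniformly_disconnected c D" and "u \<in> D" and "v \<in> D" and "u \<noteq> v" and "chained D t u v"
  shows "c * \<bar>u - v\<bar> \<le> t"
proof -
  obtain N w where w: "w 0 = u" "w N = v"
    "\<And>i. i < N \<Longrightarrow> w i \<in> D \<and> w (Suc i) \<in> D \<and> \<bar>w i - w (Suc i)\<bar> \<le> t"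
    using assms(5) unfolding chained_def rtranclp_power relpowp_fun_conv by blast
  have "N \<noteq> 0"
    using w(1,2) assms(4) by metis
  \<comment> \<open>The step condition covers indices below \<open>N\<close> only; the endpoint
    comes from \<open>v \<in> D\<close>.\<close>
  have "w i \<in> D" if "i \<le> N" for i
    using that w assms(3) by (cases "i = N") auto
  then have "c * \<bar>u - v\<bar> \<le> Max ((\<lambda>i. \<bar>w i - w (i - 1)\<bar>) ` {1..N})"
    using assms(1-4) w(1,2) unfolding uniformly_disconnected_def by blast
  also have "\<bar>w i - w (i - 1)\<bar> \<le> t" if "i \<in> {1..N}" for i
    using w(3)[of "i - 1"] that by (auto simp: abs_minus_commute)
  then have "Max ((\<lambda>i. \<bar>w i - w (i - 1)\<bar>) ` {1..N}) \<le> t"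
    using \<open>N \<noteq> 0\<close> by (subst Max_le_iff) auto
  finally show ?thesis .
qed

section \<open>Assembly of the Hoelder selection\<close>

text \<open>Stated for any admissible \<open>L\<close>, so that it serves both the given bound and
  the least Hoelder constant.\<close>

lemma holder_selection:
  fixes c \<alpha> L :: real and D :: "real set" and F :: "real \<Rightarrow> 'a::metric_space set"
  assumes "0 < c" and ud: "uniformly_disconnected c D" and "0 < \<alpha>" and "0 \<le> L"
    and F: "\<And>u. u \<in> D \<Longrightarrow> compact (F u) \<and> F u \<noteq> {}"
    and holder: "\<And>u v. u \<in> D \<Longrightarrow> v \<in> D \<Longrightarrow>
           hausdorff_dist (F u) (F v) \<le> L * \<bar>u - v\<bar> powr \<alpha>"
    and u0: "u0 \<in> D" and x0: "x0 \<in> F u0"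
  shows "\<exists>f. selection_on D F f \<and> f u0 = x0 \<and>
         (\<forall>u\<in>D. \<forall>v\<in>D. dist (f u) (f v) \<le> 8 * c powr (- \<alpha>) * L * \<bar>u - v\<bar> powr \<alpha>)"
proof -
  define t where "t n = 2 powr (real_of_int n / \<alpha>)" for n
  define E where "E n = chained D (t n)" for n
  define M where "M = c powr (- \<alpha>) * L"
  have "0 \<le> M"
    using \<open>0 \<le> L\<close> by (simp add: M_def)
  have t_powr: "t n powr \<alpha> = 2 powr n" for n
    using \<open>0 < \<alpha>\<close> by (simp add: t_def powr_powr)
  have t_pos: "0 < t n" for n
    by (simp add: t_def)
  have t_mono: "t m \<le> t n" if "m \<le> n" for m n
    using that \<open>0 < \<alpha>\<close> by (simp add: t_def divide_right_mono)
  \<comment> \<open>This writes \<open>r\<close> as a threshold with real index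
    \<open>\<alpha> * log 2 r\<close>; the ceiling of that index gives a threshold above
    \<open>r\<close>, and one less gives one strictly below.\<close>
  have t_log: "r = 2 powr (\<alpha> * log 2 r / \<alpha>)" if "0 < r" for r
    using that \<open>0 < \<alpha>\<close> by simp
  have t_above: "\<exists>n. r \<le> t n" for r
  proof (cases "0 < r")
    case True
    have "r \<le> t \<lceil>\<alpha> * log 2 r\<rceil>"
      unfolding t_def using \<open>0 < \<alpha>\<close>
      by (subst t_log[OF True], intro powr_mono divide_right_mono) auto
    then show ?thesis ..
  next
    case False
    then show ?thesis
      using t_pos[of 0] by (intro exI[of _ 0]) linarith
  qed
  have t_below: "\<exists>n. t n < r" if "0 < r" for r
  proof -
    have "t (\<lceil>\<alpha> * log 2 r\<rceil> - 1) < r"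
      unfolding t_def using \<open>0 < \<alpha>\<close>
      by (subst (2) t_log[OF that], intro powr_less_mono divide_strict_right_mono) linarith+
    then show ?thesis ..
  qed
  have E_mono: "E n u v" if "E m u v" "m \<le> n" for m n u v
    using that t_mono chained_mono unfolding E_def by blast
  have joined: "\<exists>n. E n u v" if "u \<in> D" "v \<in> D" for u v
    using t_above[of "\<bar>u - v\<bar>"] that chained_step unfolding E_def by blast
  have separated: "\<exists>n. \<not> E n u v" if "u \<in> D" "v \<in> D" "u \<noteq> v" for u v
  proof -
    obtain n where n: "t n < c * \<bar>u - v\<bar>"
      using t_below[of "c * \<bar>u - v\<bar>"] \<open>u \<noteq> v\<close> \<open>0 < c\<close> by auto
    have "\<not> E n u v"
      using n uniformly_disconnected_chained[OF ud that, of "t n"] unfolding E_def by linarith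
    then show ?thesis ..
  qed
  have step: "\<exists>y\<in>F v. dist x y \<le> M * 2 powr n" if uv: "u \<in> D" "v \<in> D" "E n u v" and x: "x \<in> F u" for n u v x
  proof -
    obtain y where y: "y \<in> F v" "dist x y \<le> hausdorff_dist (F u) (F v)"
      using hausdorff_dist_nearest[of "F u" "F v" x] F uv x by blast
    \<comment> \<open>Disconnectedness speaks of distinct points; for \<open>u = v\<close> the claim
      is positivity of \<open>t n\<close>.\<close>
    have "c * \<bar>u - v\<bar> \<le> t n"
      using uniformly_disconnected_chained[OF ud uv(1,2)] uv(3) t_pos[of n] unfolding E_def
      by (cases "u = v") auto
    then have "\<bar>u - v\<bar> powr \<alpha> \<le> (t n / c) powr \<alpha>"
      using \<open>0 < c\<close> \<open>0 < \<alpha>\<close> by (intro powr_mono2) (auto simp: field_simps)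
    also have "\<dots> = c powr (- \<alpha>) * 2 powr n"
      using \<open>0 < c\<close> t_pos[of n] by (simp add: powr_divide t_powr powr_minus_divide)
    finally have "L * \<bar>u - v\<bar> powr \<alpha> \<le> L * (c powr (- \<alpha>) * 2 powr n)"
      using \<open>0 \<le> L\<close> by (rule mult_left_mono)
    then have "L * \<bar>u - v\<bar> powr \<alpha> \<le> M * 2 powr n"
      by (simp add: M_def mult_ac)
    then show ?thesis
      using y holder[OF uv(1,2)] by force
  qed
  have final: "dist x y \<le> 8 * M * \<bar>u - v\<bar> powr \<alpha>"
    if uv: "u \<in> D" "v \<in> D" "u \<noteq> v" and xy: "\<And>n. E n u v \<Longrightarrow> dist x y \<le> 4 * M * 2 powr n"
    for x y :: 'a and u v
  proof -
    obtain m where m: "E m u v" "\<not> E (m - 1) u v"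
      using mono_pred_jump_int[of "\<lambda>n. E n u v"] E_mono joined separated uv by metis
    \<comment> \<open>Otherwise the single step from \<open>u\<close> to \<open>v\<close> would
      already join them at scale \<open>m - 1\<close>.\<close>
    have "t (m - 1) \<le> \<bar>u - v\<bar>"
      using m(2) chained_step[OF uv(1,2), of "t (m - 1)"] unfolding E_def by linarith
    then have "t (m - 1) powr \<alpha> \<le> \<bar>u - v\<bar> powr \<alpha>"
      using \<open>0 < \<alpha>\<close> t_pos[of "m - 1"] by (intro powr_mono2) auto
    then have "2 powr m \<le> 2 * \<bar>u - v\<bar> powr \<alpha>"
      unfolding t_powr by (simp add: powr_diff)
    then have "4 * M * 2 powr m \<le> 4 * M * (2 * \<bar>u - v\<bar> powr \<alpha>)"
      using \<open>0 \<le> M\<close> by (intro mult_left_mono) auto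
    then show ?thesis
      using xy[OF m(1)] by simp
  qed
  \<comment> \<open>Shrinking the set at \<open>u0\<close> to the compact singleton
    \<open>{x0}\<close> carries the prescribed value through the compactness argument.\<close>
  have "\<exists>f. (\<forall>u\<in>D. f u \<in> (F(u0 := {x0})) u) \<and>
          (\<forall>u\<in>D. \<forall>v\<in>D. dist (f u) (f v) \<le> 8 * M * \<bar>u - v\<bar> powr \<alpha>)"
  proof (rule compact_selection_from_finite)
    show "compact ((F(u0 := {x0})) u)" if "u \<in> D" for u
      using F that by simp
  next
    fix S assume S: "finite S" "S \<subseteq> D"
    \<comment> \<open>Adding \<open>u0\<close> to \<open>S\<close> provides the root even when
      \<open>S\<close> misses it.\<close>
    have "\<exists>f. f u0 = x0 \<and> (\<forall>u\<in>insert u0 S. f u \<in> F u) \<and>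
           (\<forall>n. \<forall>u\<in>insert u0 S. E n u u0 \<longrightarrow> dist (f u) x0 \<le> 2 * M * 2 powr n) \<and>
           (\<forall>n. \<forall>u\<in>insert u0 S. \<forall>v\<in>insert u0 S.
              E n u v \<longrightarrow> dist (f u) (f v) \<le> 4 * M * 2 powr n)"
    proof (rule finite_tree_selection[of E D F M])
      show "E n u u" for n u
        unfolding E_def by (rule chained_refl)
      show "E n v u" if "E n u v" for n u v
        using that unfolding E_def by (rule chained_sym)
      show "E n u w" if "E n u v" "E n v w" for n u v w
        using that unfolding E_def by (rule chained_trans)
    qed (use S u0 x0 \<open>0 \<le> M\<close> E_mono joined separated step in auto)
    then obtain f where f: "f u0 = x0" "\<And>u. u \<in> S \<Longrightarrow> f u \<in> F u"
      "\<And>n u v. u \<in> S \<Longrightarrow> v \<in> S \<Longrightarrow> E n u v \<Longrightarrow> dist (f u) (f v) \<le> 4 * M * 2 powr n"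
      by blast
    have "dist (f u) (f v) \<le> 8 * M * \<bar>u - v\<bar> powr \<alpha>" if "u \<in> S" "v \<in> S" for u v
      using final[of u v "f u" "f v"] f(3)[of u v] that S(2) by (cases "u = v") auto
    then show "\<exists>f. (\<forall>u\<in>S. f u \<in> (F(u0 := {x0})) u) \<and>
          (\<forall>u\<in>S. \<forall>v\<in>S. dist (f u) (f v) \<le> 8 * M * \<bar>u - v\<bar> powr \<alpha>)"
      using f(1,2) by (intro exI[of _ f]) auto
  qed
  then obtain f where f: "\<And>u. u \<in> D \<Longrightarrow> f u \<in> (F(u0 := {x0})) u"
    "\<And>u v. u \<in> D \<Longrightarrow> v \<in> D \<Longrightarrow> dist (f u) (f v) \<le> 8 * M * \<bar>u - v\<bar> powr \<alpha>"
    by blast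
  have "f u0 = x0"
    using f(1)[OF u0] by simp
  moreover have "f u \<in> F u" if "u \<in> D" for u
    using f(1)[OF that] x0 by (auto split: if_splits)
  ultimately show ?thesis
    using f(2) unfolding selection_on_def M_def by (intro exI[of _ f]) (auto simp: mult_ac)
qed

theorem theorem3p3:
  fixes c \<alpha> L :: real and D :: "real set"
    and F :: "real \<Rightarrow> 'a::metric_space set"
  assumes "0 < c" and "c \<le> 1"
    and "uniformly_disconnected c D"
    and "0 < \<alpha>" and "0 \<le> L"
    and "\<And>u. u \<in> D \<Longrightarrow> compact (F u) \<and> F u \<noteq> {}"
    and "\<And>u v. u \<in> D \<Longrightarrow> v \<in> D \<Longrightarrow>
           hausdorff_dist (F u) (F v) \<le> L * \<bar>u - v\<bar> powr \<alpha>"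
  shows "\<forall>u0\<in>D. \<forall>x0\<in>F u0.
      (\<exists>f. selection_on D F f \<and> f u0 = x0 \<and>
         (\<forall>u\<in>D. \<forall>v\<in>D. dist (f u) (f v) \<le> 8 * c powr (- \<alpha>) * L * \<bar>u - v\<bar> powr \<alpha>)) \<and>
      (\<exists>f. selection_on D F f \<and> f u0 = x0 \<and>
         (\<exists>K. holder_bound dist \<alpha> D f K) \<and>
         holder_const dist \<alpha> D f
           \<le> 8 * c powr (- \<alpha>) * holder_const hausdorff_dist \<alpha> D F)"
proof (intro ballI conjI)
  fix u0 x0
  assume u0: "u0 \<in> D" and x0: "x0 \<in> F u0"
  show "\<exists>f. selection_on D F f \<and> f u0 = x0 \<and>
         (\<forall>u\<in>D. \<forall>v\<in>D. dist (f u) (f v) \<le> 8 * c powr (- \<alpha>) * L * \<bar>u - v\<bar> powr \<alpha>)"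
    using holder_selection assms u0 x0 by blast
  \<comment> \<open>The least constant is attained, so it is itself an admissible bound for a second
    application.\<close>
  define L' where "L' = holder_const hausdorff_dist \<alpha> D F"
  have "holder_bound hausdorff_dist \<alpha> D F L"
    using assms by (simp add: holder_bound_def)
  then have "holder_bound hausdorff_dist \<alpha> D F L'"
    unfolding L'_def by (rule holder_const_least)
  then have L': "0 \<le> L'"
    "\<And>u v. u \<in> D \<Longrightarrow> v \<in> D \<Longrightarrow> hausdorff_dist (F u) (F v) \<le> L' * \<bar>u - v\<bar> powr \<alpha>"
    by (auto simp: holder_bound_def)
  obtain f where f: "selection_on D F f" "f u0 = x0"
    "\<forall>u\<in>D. \<forall>v\<in>D. dist (f u) (f v) \<le> 8 * c powr (- \<alpha>) * L' * \<bar>u - v\<bar> powr \<alpha>"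
    using holder_selection[OF assms(1,3,4) L'(1) assms(6) L'(2) u0 x0] by blast
  \<comment> \<open>This bound also shows that the least constant of \<open>f\<close>
    exists.\<close>
  have "holder_bound dist \<alpha> D f (8 * c powr (- \<alpha>) * L')"
    using f(3) L'(1) by (simp add: holder_bound_def)
  then show "\<exists>f. selection_on D F f \<and> f u0 = x0 \<and>
         (\<exists>K. holder_bound dist \<alpha> D f K) \<and>
         holder_const dist \<alpha> D f
           \<le> 8 * c powr (- \<alpha>) * holder_const hausdorff_dist \<alpha> D F"
    using f(1,2) holder_const_least(2) unfolding L'_def by blast
qed

end
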